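(* Let $\widehat E=E+\varepsilon E_0$ and $\widehat F=F+\varepsilon F_0$ be dual matrices in $\mathbb{D}^{m\times n}$ whose dual Moore-Penrose generalized inverses (DMPGIs) exist. Then $\widehat E\overset{\rm D}{\leq}\widehat F$ (Dual-minus order) if and only if $$\mathrm{rk}(\widehat F)-\mathrm{rk}(\widehat E)=\mathrm{rk}(\widehat F-\widehat E).$$
   Context: $\varepsilon$ is the dual unit: $\varepsilon\neq 0$, $\varepsilon^2=0$, commuting with reals. $\mathbb{D}^{m\times n}$ is the set of $m\times n$ dual matrices $\widehat E=E+\varepsilon E_0$ with $E,E_0\in\mathbb{R}^{m\times n}$, with the obvious addition, multiplication and transpose $\widehat E^{T}=E^T+\varepsilon E_0^T$. The DMPGI of $\widehat E\in\mathbb{D}^{m\times n}$ is the unique $\widehat X\in\mathbb{D}^{n\times m}$, if it exists, with $\widehat E\widehat X\widehat E=\widehat E$, $\widehat X\widehat E\widehat X=\widehat X$, $(\widehat E\widehat X)^T=\widehat E\widehat X$, $(\widehat X\widehat E)^T=\widehat X\widehat E$. Rank of a dual matrix: $\mathrm{rk}(\widehat E)=\mathrm{rk}\begin{pmatrix} E_0 & E \\ E & O \end{pmatrix}-\mathrm{rk}(E)$, where on the right $\mathrm{rk}$ is the usual rank of real matrices. Minus partial order on real matrices of the same size: $E\leq F$ means $\mathrm{rk}(F-E)=\mathrm{rk}(F)-\mathrm{rk}(E)$. Dual-minus order: for $\widehat E,\widehat F\in\mathbb{D}^{m\times n}$ whose DMPGIs exist, $\widehat E\overset{\rm D}{\leq}\widehat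 F$ means that $E\leq F$ and the DMPGI of $\widehat F-\widehat E$ exists. *)

theory Defs
  imports "HOL-Analysis.Analysis"
begin

datatype dual_num = Dual (std_part: real) (inf_part: real)

lemma dual_num_eq_iff: "x = y \<longleftrightarrow> std_part x = std_part y \<and> inf_part x = inf_part y"
  by (cases x; cases y) simp

text \<open>\<open>Dual a b\<close> stands for \<open>a + \<epsilon> b\<close> with \<open>\<epsilon> \<noteq> 0\<close> and \<open>\<epsilon>\<^sup>2 = 0\<close>.\<close>

instantiation dual_num :: comm_ring_1
begin

definition "0 = Dual 0 0"
definition "1 = Dual 1 0"
definition "x + y = Dual (std_part x + std_part y) (inf_part x + inf_part y)"
definition "- x = Dual (- std_part x) (- inf_part x)"
definition "x - y = Dual (std_part x - std_part y) (inf_part x - inf_part y)"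
definition "x * y =
  Dual (std_part x * std_part y) (std_part x * inf_part y + inf_part x * std_part y)"

instance
  by standard
     (auto simp: dual_num_eq_iff zero_dual_num_def one_dual_num_def plus_dual_num_def
        uminus_dual_num_def minus_dual_num_def times_dual_num_def algebra_simps)

end

definition dual_unit :: dual_num
  where "dual_unit = Dual 0 1"

lemma dual_unit_nonzero: "dual_unit \<noteq> 0"
  by (simp add: dual_unit_def zero_dual_num_def)

lemma dual_unit_square: "dual_unit * dual_unit = 0"
  by (simp add: dual_unit_def zero_dual_num_def times_dual_num_def)

lemma Dual_eq: "Dual a b = Dual a 0 + dual_unit * Dual b 0"
  by (simp add: dual_unit_def plus_dual_num_def times_dual_num_def)

text \<open>An \<open>m \<times> n\<close> dual matrix is a library matrix over \<^typ>\<open>dual_num\<close>; its sum, difference, product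
  and transpose are the library ones.  \<open>dual_matrix E E\<^sub>0\<close> is \<open>E + \<epsilon> E\<^sub>0\<close>.\<close>

definition dual_matrix :: "real^'n^'m \<Rightarrow> real^'n^'m \<Rightarrow> dual_num^'n^'m"
  where "dual_matrix E E\<^sub>0 = (\<chi> i j. Dual (E $ i $ j) (E\<^sub>0 $ i $ j))"

abbreviation std_matrix :: "dual_num^'n^'m \<Rightarrow> real^'n^'m"
  where "std_matrix \<equiv> map_matrix std_part"

abbreviation inf_matrix :: "dual_num^'n^'m \<Rightarrow> real^'n^'m"
  where "inf_matrix \<equiv> map_matrix inf_part"

lemma std_matrix_dual_matrix [simp]: "std_matrix (dual_matrix E E\<^sub>0) = E"
  and inf_matrix_dual_matrix [simp]: "inf_matrix (dual_matrix E E\<^sub>0) = E\<^sub>0"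
  and dual_matrix_std_inf [simp]: "dual_matrix (std_matrix A) (inf_matrix A) = A"
  by (simp_all add: vec_eq_iff dual_matrix_def)

lemma dual_matrix_mult:
  "dual_matrix A A\<^sub>0 ** dual_matrix B B\<^sub>0 = dual_matrix (A ** B) (A ** B\<^sub>0 + A\<^sub>0 ** B)"
proof -
  have std: "std_part (sum f S) = (\<Sum>x\<in>S. std_part (f x))"
    and inf: "inf_part (sum f S) = (\<Sum>x\<in>S. inf_part (f x))" for f :: "'x \<Rightarrow> dual_num" and S
    by (induction S rule: infinite_finite_induct; simp add: zero_dual_num_def plus_dual_num_def)+
  show ?thesis
    by (simp add: vec_eq_iff dual_num_eq_iff dual_matrix_def matrix_matrix_mult_def std inf
        times_dual_num_def sum.distrib)
qed

lemma dual_matrix_diff: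
  "dual_matrix A A\<^sub>0 - dual_matrix B B\<^sub>0 = dual_matrix (A - B) (A\<^sub>0 - B\<^sub>0)"
  by (simp add: vec_eq_iff dual_matrix_def minus_dual_num_def)

lemma transpose_dual_matrix:
  "transpose (dual_matrix A A\<^sub>0) = dual_matrix (transpose A) (transpose A\<^sub>0)"
  by (simp add: vec_eq_iff dual_matrix_def transpose_def)

definition is_DMPGI :: "dual_num^'n^'m \<Rightarrow> dual_num^'m^'n \<Rightarrow> bool"
  where "is_DMPGI A X \<longleftrightarrow>
    A ** X ** A = A \<and> X ** A ** X = X \<and>
    transpose (A ** X) = A ** X \<and> transpose (X ** A) = X ** A"

lemma is_DMPGI_unique:
  assumes X: "is_DMPGI A X" and Y: "is_DMPGI A Y"
  shows "X = Y"
proof -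
  have "A ** X = transpose (A ** X)"
    using X by (simp add: is_DMPGI_def)
  also have "\<dots> = transpose ((A ** Y) ** (A ** X))"
    using Y by (simp add: is_DMPGI_def matrix_mul_assoc)
  also have "\<dots> = (A ** X) ** (A ** Y)"
    using X Y by (simp only: matrix_transpose_mul is_DMPGI_def)
  also have "\<dots> = A ** Y"
    using X by (simp add: is_DMPGI_def matrix_mul_assoc)
  finally have 1: "A ** X = A ** Y" .
  have "X ** A = transpose (X ** A)"
    using X by (simp add: is_DMPGI_def)
  also have "\<dots> = transpose ((X ** A) ** (Y ** A))"
    using Y by (metis is_DMPGI_def matrix_mul_assoc)
  also have "\<dots> = (Y ** A) ** (X ** A)"
    using X Y by (simp only: matrix_transpose_mul is_DMPGI_def)
  also have "\<dots> = Y ** A"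
    using X by (metis is_DMPGI_def matrix_mul_assoc)
  finally have 2: "X ** A = Y ** A" .
  have "X = X ** A ** X"
    using X by (simp add: is_DMPGI_def)
  also have "\<dots> = Y ** A ** Y"
    using 1 2 by (metis matrix_mul_assoc)
  also have "\<dots> = Y"
    using Y by (simp add: is_DMPGI_def)
  finally show ?thesis .
qed

definition has_DMPGI :: "dual_num^'n^'m \<Rightarrow> bool"
  where "has_DMPGI A \<longleftrightarrow> (\<exists>X. is_DMPGI A X)"

definition block_matrix ::
    "real^'n^'m \<Rightarrow> real^'l^'m \<Rightarrow> real^'n^'k \<Rightarrow> real^'l^'k \<Rightarrow> real^('n + 'l)^('m + 'k)"
  where "block_matrix A B C D =
    (\<chi> i j. case i of
        Inl a \<Rightarrow> (case j of Inl b \<Rightarrow> A $ a $ b | Inr b \<Rightarrow> B $ a $ b)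
      | Inr a \<Rightarrow> (case j of Inl b \<Rightarrow> C $ a $ b | Inr b \<Rightarrow> D $ a $ b))"

text \<open>Ranks are compared as integers, so that no difference of ranks is truncated.\<close>

definition dual_rank :: "dual_num^'n^'m \<Rightarrow> int"
  where "dual_rank A =
    int (rank (block_matrix (inf_matrix A) (std_matrix A) (std_matrix A) 0))
      - int (rank (std_matrix A))"

definition minus_le :: "real^'n^'m \<Rightarrow> real^'n^'m \<Rightarrow> bool"
  where "minus_le E F \<longleftrightarrow> int (rank (F - E)) = int (rank F) - int (rank E)"

text \<open>The dual-minus order relates only dual matrices that have a DMPGI.\<close>

definition dual_minus_le :: "dual_num^'n^'m \<Rightarrow> dual_num^'n^'m \<Rightarrow> bool"
  where "dual_minus_le A B \<longleftrightarrow>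
    has_DMPGI A \<and> has_DMPGI B \<and> minus_le (std_matrix A) (std_matrix B) \<and> has_DMPGI (B - A)"

end

(*
The kernel of the block matrix (E0 E; E 0) consists of the pairs (x, y) with E x = 0 and
E0 x + E y = 0, so its dimension is dim (ker E) + dim {x \<in> ker E. E0 x \<in> range E}.  Hence the dual
rank of E + \<epsilon> E0 is at least rk E, with equality iff E0 maps ker E into range E, and this is exactly
the condition for the DMPGI to exist.  When the DMPGIs of both given matrices exist, the rank equation
squeezes rk (F - E) between rk F - rk E and the dual rank of the difference.
*)
theory Submission
  imports Defs
begin

section \<open>Algebraic rules for matrix products and transposes\<close>

lemma matrix_add_rdistrib: "(A + B) ** C = A ** C + B ** (C :: 'a::semiring_1^'l^'n)"
  by (simp add: matrix_matrix_mult_def vec_eq_iff distrib_right sum.distrib)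

lemma matrix_diff_rdistrib: "(A - B) ** C = A ** C - B ** (C :: 'a::ring_1^'l^'n)"
  by (simp add: matrix_matrix_mult_def vec_eq_iff left_diff_distrib sum_subtractf)

lemma matrix_diff_ldistrib: "(A :: 'a::ring_1^'n^'m) ** (B - C) = A ** B - A ** C"
  by (simp add: matrix_matrix_mult_def vec_eq_iff right_diff_distrib sum_subtractf)

lemma matrix_mul_lzero: "0 ** (B :: 'a::semiring_1^'l^'n) = 0"
  by (simp add: matrix_matrix_mult_def vec_eq_iff)

lemma matrix_mul_rzero: "(A :: 'a::semiring_1^'n^'m) ** 0 = 0"
  by (simp add: matrix_matrix_mult_def vec_eq_iff)

lemma transpose_add: "transpose (A + B) = transpose A + transpose B"
  by (simp add: transpose_def vec_eq_iff)

lemma transpose_diff: "transpose (A - B) = transpose A - transpose B"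
  by (simp add: transpose_def vec_eq_iff)

section \<open>Rank, nullity and subadditivity for real matrices\<close>

text \<open>The kernel is the orthogonal complement of the row space, and the row space has
  dimension \<open>rank A\<close>.\<close>

lemma rank_plus_nullity:
  fixes A :: "real^'n^'m"
  shows "rank A + dim {x. A *v x = 0} = CARD('n)"
proof -
  let ?R = "range ((*v) (transpose A))"
  have "subspace ?R"
    using matrix_vector_mul_linear linear_subspace_image subspace_UNIV by blast
  moreover have "{x. A *v x = 0} = {y \<in> UNIV. \<forall>x\<in>?R. orthogonal x y}"
  proof -
    have "A *v y = 0 \<longleftrightarrow> (\<forall>x. inner x (A *v y) = 0)" for y
      by (metis inner_eq_zero_iff inner_zero_right)
    then show ?thesis
      by (auto simp: orthogonal_def dot_lmul_matrix)
  qed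
  moreover have "rank A = dim ?R"
    using rank_dim_range[of "transpose A"] by (simp only: rank_transpose)
  ultimately show ?thesis
    using dim_subspace_orthogonal_to_vectors[of ?R UNIV] by (simp add: dim_UNIV)
qed

text \<open>Since \<open>A *v x = B *v x + (A - B) *v x\<close>, the range of \<open>A\<close> lies
  in the sum of the other two ranges.\<close>

lemma rank_le_add_rank_diff:
  fixes A B :: "real^'n^'m"
  shows "rank A \<le> rank B + rank (A - B)"
proof -
  let ?S = "range ((*v) B)" and ?T = "range ((*v) (A - B))"
  have sub: "subspace ?S" "subspace ?T"
    using matrix_vector_mul_linear linear_subspace_image subspace_UNIV by blast+
  have "range ((*v) A) \<subseteq> {x + y |x y. x \<in> ?S \<and> y \<in> ?T}"
  proof
    fix v assume "v \<in> range ((*v) A)"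
    then obtain x where "v = B *v x + (A - B) *v x"
      by (auto simp: matrix_vector_mult_diff_rdistrib)
    then show "v \<in> {x + y |x y. x \<in> ?S \<and> y \<in> ?T}" by blast
  qed
  then have "rank A \<le> dim {x + y |x y. x \<in> ?S \<and> y \<in> ?T}"
    by (simp add: rank_dim_range dim_subset)
  also have "\<dots> \<le> dim ?S + dim ?T"
    using dim_sums_Int[OF sub] by simp
  finally show ?thesis by (simp add: rank_dim_range)
qed

section \<open>The real Moore-Penrose inverse\<close>

text \<open>Least squares: the component of \<open>y\<close> orthogonal to the range of
  \<open>A\<close> is killed by \<open>transpose A\<close>, and the other component has the form
  \<open>A *v x\<close>.\<close>

lemma normal_equations_solvable:
  fixes A :: "real^'n^'m"
  obtains K where "transpose A ** A ** K = transpose A"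
proof -
  have "\<exists>x. transpose A *v (A *v x) = transpose A *v y" for y
  proof -
    have sp: "span (range ((*v) A)) = range ((*v) A)"
      by (meson matrix_vector_mul_linear linear_subspace_image subspace_UNIV span_eq_iff)
    obtain p q where p: "p \<in> range ((*v) A)"
      and q: "\<And>w. w \<in> range ((*v) A) \<Longrightarrow> orthogonal q w" and y: "y = p + q"
      using orthogonal_subspace_decomp_exists[of "range ((*v) A)" y] unfolding sp by metis
    have "inner (q v* A) z = 0" for z
      using q by (simp add: dot_lmul_matrix orthogonal_def)
    then have "q v* A = 0"
      using inner_eq_zero_iff by blast
    then have "transpose A *v q = 0" by simp
    then show ?thesis
      using p y by (metis (no_types, lifting) add.right_neutral imageE matrix_vector_right_distrib)
  qed
  then obtain k where k: "\<And>y. transpose A *v (A *v k y) = transpose A *v y"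
    by metis
  \<comment> \<open>The choice function \<open>k\<close> need not be linear, so \<open>K\<close> is
    assembled from its values at the basis vectors and the identity is checked column by
    column.\<close>
  define K where "K = (\<chi> i j. k (axis j 1) $ i)"
  have col: "K *v axis j 1 = k (axis j 1)" for j
    by (simp add: K_def matrix_vector_mult_basis column_def vec_eq_iff)
  have "transpose A ** A ** K = transpose A"
  proof -
    have "column j (transpose A ** A ** K) = column j (transpose A)" for j
      using k[of "axis j 1"]
      by (simp only: matrix_vector_mult_basis[symmetric] matrix_vector_mul_assoc[symmetric] col)
    then show ?thesis
      by (simp add: column_def vec_eq_iff)
  qed
  then show ?thesis by (rule that)
qed

lemma Moore_Penrose_exists:
  fixes A :: "real^'n^'m"
  obtains G where "A ** G ** A = A" "G ** A ** G = G"
    "transpose (A ** G) = A ** G" "transpose (G ** A) = G ** A"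
proof -
  have inner_inv: "\<exists>K. B ** K ** B = B \<and> transpose (B ** K) = B ** K" for B :: "real^'p^'q"
  proof -
    obtain K where K: "transpose B ** B ** K = transpose B"
      by (rule normal_equations_solvable)
    \<comment> \<open>The left side is a Gram matrix, hence symmetric; so the equation makes
      \<open>B ** K\<close> symmetric.\<close>
    have "transpose (B ** K) ** (B ** K) = transpose (B ** K)"
      by (metis K matrix_mul_assoc matrix_transpose_mul)
    then have sym: "transpose (B ** K) = B ** K"
      by (metis matrix_transpose_mul transpose_transpose)
    moreover have "B ** K ** B = B"
      by (metis K sym matrix_mul_assoc matrix_transpose_mul transpose_transpose)
    ultimately show ?thesis by blast
  qed
  obtain K where K: "A ** K ** A = A" "transpose (A ** K) = A ** K"
    using inner_inv by blast
  \<comment> \<open>Transposing the result for \<open>transpose A\<close> gives an inner inverse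
    \<open>H\<close> of \<open>A\<close> with the other product symmetric.\<close>
  obtain H' where H': "transpose A ** H' ** transpose A = transpose A"
    "transpose (transpose A ** H') = transpose A ** H'"
    using inner_inv by blast
  define H where "H = transpose H'"
  have H: "A ** H ** A = A" "transpose (H ** A) = H ** A"
    using H' unfolding H_def
    by (metis matrix_mul_assoc matrix_transpose_mul transpose_transpose)+
  have 1: "A ** (H ** A ** K) = A ** K" "H ** A ** K ** A = H ** A"
    using H K by (metis matrix_mul_assoc)+
  show ?thesis
  \<comment> \<open>The product \<open>H ** A ** K\<close> takes one symmetry from each factor: its
    products with \<open>A\<close> are \<open>A ** K\<close> and \<open>H ** A\<close>.\<close>
  proof (rule that[of "H ** A ** K"])
    show "A ** (H ** A ** K) ** A = A" "H ** A ** K ** A ** (H ** A ** K) = H ** A ** K"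
      using 1 H K by (metis matrix_mul_assoc)+
  qed (use 1 H K in simp_all)
qed

section \<open>Existence of the DMPGI\<close>

text \<open>For necessity, the infinitesimal part of the first Penrose equation is applied to a
  kernel vector of \<open>E\<close>. For sufficiency, the real inverse \<open>G\<close> is the
  standard part, and an infinitesimal part \<open>X0\<close> is constructed explicitly.\<close>

lemma has_DMPGI_iff:
  fixes E E0 :: "real^'n^'m"
  shows "has_DMPGI (dual_matrix E E0) \<longleftrightarrow> (\<forall>x. E *v x = 0 \<longrightarrow> E0 *v x \<in> range ((*v) E))"
proof
  assume "has_DMPGI (dual_matrix E E0)"
  then obtain X where "dual_matrix E E0 ** X ** dual_matrix E E0 = dual_matrix E E0"
    by (auto simp: has_DMPGI_def is_DMPGI_def)
  then have "dual_matrix E E0 ** dual_matrix (std_matrix X) (inf_matrix X) ** dual_matrix E E0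
      = dual_matrix E E0"
    by simp
  then have E0: "(E ** std_matrix X) ** E0 + (E ** inf_matrix X + E0 ** std_matrix X) ** E = E0"
    by (metis dual_matrix_mult inf_matrix_dual_matrix)
  show "\<forall>x. E *v x = 0 \<longrightarrow> E0 *v x \<in> range ((*v) E)"
  proof (intro allI impI)
    fix x assume x: "E *v x = 0"
    have "E0 *v x = ((E ** std_matrix X) ** E0 + (E ** inf_matrix X + E0 ** std_matrix X) ** E) *v x"
      by (simp only: E0)
    also have "\<dots> = E *v (std_matrix X *v (E0 *v x))"
      using x by (simp only: matrix_vector_mult_add_rdistrib matrix_vector_mul_assoc[symmetric])
        simp
    finally show "E0 *v x \<in> range ((*v) E)" by blast
  qed
next
  assume ker: "\<forall>x. E *v x = 0 \<longrightarrow> E0 *v x \<in> range ((*v) E)"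
  obtain G where G: "E ** G ** E = E" "G ** E ** G = G"
    "transpose (E ** G) = E ** G" "transpose (G ** E) = G ** E"
    by (rule Moore_Penrose_exists)
  \<comment> \<open>\<open>P\<close> and \<open>Q\<close> are the orthogonal projections onto the
    complement of the range of \<open>E\<close> and onto the kernel of \<open>E\<close>.\<close>
  define P where "P = mat 1 - E ** G"
  define Q where "Q = mat 1 - G ** E"
  have PE: "P ** E = 0" and EQ: "E ** Q = 0" and QG: "Q ** G = 0"
    and symP: "transpose P = P" and symQ: "transpose Q = Q"
    unfolding P_def Q_def
    by (simp_all add: matrix_diff_rdistrib matrix_diff_ldistrib transpose_diff G matrix_mul_assoc)
  \<comment> \<open>This is the kernel condition in matrix form: \<open>Q\<close> maps into the
    kernel, \<open>E0\<close> carries that into the range, and \<open>P\<close> annihilates the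
    range.\<close>
  have PEQ: "P ** E0 ** Q = 0"
  proof -
    have "(P ** E0 ** Q) *v x = 0" for x
    proof -
      have "E *v (Q *v x) = 0"
        by (simp add: matrix_vector_mul_assoc EQ)
      then obtain y where "E0 *v (Q *v x) = E *v y"
        using ker by blast
      then show ?thesis
        by (metis PE matrix_vector_mul_assoc matrix_vector_mult_0)
    qed
    then show ?thesis
      by (simp add: matrix_eq)
  qed
  \<comment> \<open>\<open>U = G G\<^sup>T E0\<^sup>T P\<close> and \<open>V = Q E0\<^sup>T G\<^sup>T G\<close> are chosen to symmetrize the infinitesimal parts
    \<open>P E0 G\<close> and \<open>G E0 Q\<close> of the two products; \<open>- G E0 G\<close> alone would give a reflexive inverse.\<close>
  define U where "U = G ** transpose (P ** E0 ** G)"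
  define V where "V = transpose (G ** E0 ** Q) ** G"
  define X0 where "X0 = U + V - G ** E0 ** G"
  have EU: "E ** U = transpose (P ** E0 ** G)"
    unfolding U_def by (metis G(2,3) matrix_mul_assoc matrix_transpose_mul)
  have VE: "V ** E = transpose (G ** E0 ** Q)"
    unfolding V_def by (metis G(2,4) matrix_mul_assoc matrix_transpose_mul)
  have EV: "E ** V = 0"
    unfolding V_def
    by (metis EQ symQ matrix_mul_assoc matrix_transpose_mul matrix_mul_lzero)
  have UE: "U ** E = 0"
    unfolding U_def
    by (metis PE symP matrix_mul_assoc matrix_transpose_mul matrix_mul_rzero)
  \<comment> \<open>The infinitesimal part of each product becomes a matrix plus its own transpose,
    which is visibly symmetric.\<close>
  have EX: "E ** X0 + E0 ** G = P ** E0 ** G + transpose (P ** E0 ** G)"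
    unfolding X0_def
    by (simp add: matrix_add_ldistrib matrix_diff_ldistrib EU EV)
      (simp add: P_def matrix_diff_rdistrib matrix_mul_assoc)
  have XE: "G ** E0 + X0 ** E = G ** E0 ** Q + transpose (G ** E0 ** Q)"
    unfolding X0_def
    by (simp add: matrix_add_rdistrib matrix_diff_rdistrib UE VE)
      (simp add: Q_def matrix_diff_ldistrib matrix_mul_assoc)
  have EXE: "E ** G ** E0 + (E ** X0 + E0 ** G) ** E = E0"
  proof -
    have "transpose (P ** E0 ** G) ** E = 0"
      by (metis UE EU matrix_mul_assoc matrix_mul_rzero)
    \<comment> \<open>The obstruction to the first Penrose equation is exactly
      \<open>P ** E0 ** Q\<close>; this is where the kernel condition enters.\<close>
    moreover have "E ** G ** E0 + P ** E0 ** G ** E = E0 - P ** E0 ** Q"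
      by (simp add: P_def Q_def matrix_diff_rdistrib matrix_diff_ldistrib matrix_mul_assoc)
    ultimately show ?thesis
      by (simp add: EX matrix_add_rdistrib PEQ)
  qed
  have XEX: "G ** E ** X0 + (G ** E0 + X0 ** E) ** G = X0"
  proof -
    have "G ** E ** U = U"
      unfolding U_def by (simp add: matrix_mul_assoc G)
    moreover have "G ** E ** V = 0"
      by (metis EV matrix_mul_assoc matrix_mul_rzero)
    moreover have "G ** E0 ** Q ** G = 0"
      by (metis QG matrix_mul_assoc matrix_mul_rzero)
    ultimately show ?thesis
      by (simp add: XE V_def[symmetric] matrix_add_rdistrib)
        (simp add: X0_def matrix_add_ldistrib matrix_diff_ldistrib matrix_mul_assoc G)
  qed
  have "is_DMPGI (dual_matrix E E0) (dual_matrix G X0)"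
    unfolding is_DMPGI_def dual_matrix_mult transpose_dual_matrix
    by (simp add: G EX XE EXE[unfolded EX] XEX[unfolded XE] transpose_add add.commute)
  then show "has_DMPGI (dual_matrix E E0)"
    by (auto simp: has_DMPGI_def)
qed

section \<open>The dual rank as a kernel dimension\<close>

lemma block_matrix_mult_vec:
  "block_matrix A B C D *v (\<chi> i. case i of Inl a \<Rightarrow> x $ a | Inr b \<Rightarrow> y $ b)
    = (\<chi> i. case i of Inl a \<Rightarrow> (A *v x + B *v y) $ a | Inr b \<Rightarrow> (C *v x + D *v y) $ b)"
proof -
  have split: "(\<Sum>i\<in>UNIV. f i) = (\<Sum>a\<in>UNIV. f (Inl a)) + (\<Sum>b\<in>UNIV. f (Inr b))"
    for f :: "'p::finite + 'q::finite \<Rightarrow> real"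
    by (simp add: UNIV_Plus_UNIV[symmetric] sum.Plus del: UNIV_Plus_UNIV)
  show ?thesis
    by (simp add: vec_eq_iff block_matrix_def matrix_vector_mult_def split split: sum.split)
qed

lemma subspace_kernel_preimage_range:
  fixes A B :: "real^'n^'m"
  shows "subspace {x. A *v x = 0 \<and> B *v x \<in> range ((*v) A)}"
proof -
  have "subspace (range ((*v) A))"
    using matrix_vector_mul_linear linear_subspace_image subspace_UNIV by blast
  from subspace_0[OF this] subspace_add[OF this] subspace_scale[OF this]
  show ?thesis
    by (simp add: subspace_def matrix_vector_right_distrib matrix_vector_mult_scaleR)
qed

text \<open>The block matrix has twice as many columns as \<open>E\<close> and nullity
  \<open>dim ?S + dim ?N\<close>. Subtracting \<open>rank E\<close> cancels \<open>dim ?N\<close>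
  and one copy of \<open>CARD('n)\<close>.\<close>

lemma dual_rank_eq:
  fixes E E0 :: "real^'n^'m"
  shows "dual_rank (dual_matrix E E0)
    = int CARD('n) - int (dim {x. E *v x = 0 \<and> E0 *v x \<in> range ((*v) E)})"
proof -
  let ?M = "block_matrix E0 E E 0"
  let ?N = "{x. E *v x = 0}"
  let ?S = "{x. E *v x = 0 \<and> E0 *v x \<in> range ((*v) E)}"
  obtain G where G: "E ** G ** E = E"
    by (rule Moore_Penrose_exists)
  define J :: "(real^'n) \<times> (real^'n) \<Rightarrow> real^('n + 'n)" where "J = (\<lambda>(x, z).
    \<chi> i. case i of Inl a \<Rightarrow> x $ a | Inr b \<Rightarrow> (z - G *v (E0 *v x)) $ b)"
  \<comment> \<open>On \<open>ker M\<close>, \<open>y + G E0 x\<close> lies in \<open>ker E\<close>, so the shear \<open>J\<close> straightens \<open>ker M\<close> to a product.\<close>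
  have linJ: "linear J"
    by (rule linearI)
      (auto simp: J_def vec_eq_iff algebra_simps matrix_vector_mult_scaleR split: sum.split)
  have injJ: "inj J"
  proof (rule injI)
    fix p q assume eq: "J p = J q"
    obtain x z x' z' where pq: "p = (x, z)" "q = (x', z')" by fastforce
    have "J p $ Inl a = J q $ Inl a" "J p $ Inr a = J q $ Inr a" for a
      using eq by simp_all
    then have "x = x'" and "z - G *v (E0 *v x) = z' - G *v (E0 *v x')"
      by (simp_all add: pq J_def vec_eq_iff)
    then show "p = q" by (simp add: pq)
  qed
  have M_J: "?M *v J (x, z) = 0 \<longleftrightarrow> E *v x = 0 \<and> E0 *v x + E *v (z - G *v (E0 *v x)) = 0" for x z
    unfolding J_def prod.case block_matrix_mult_vec
    by (auto simp: vec_eq_iff split: sum.split)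
  have GE: "E *v (G *v (E *v y)) = E *v y" for y
    by (metis G matrix_vector_mul_assoc)
  have image: "J ` (?S \<times> ?N) = {v. ?M *v v = 0}"
  proof -
    have "v \<in> J ` (?S \<times> ?N)" if v: "?M *v v = 0" for v
    proof -
      define x where "x = (\<chi> a. v $ Inl a)"
      \<comment> \<open>This undoes the shear \<open>J\<close>.\<close>
      define z where "z = (\<chi> b. v $ Inr b) + G *v (E0 *v x)"
      have vJ: "v = J (x, z)"
        by (simp add: J_def x_def z_def vec_eq_iff split: sum.split)
      with v M_J have Ex: "E *v x = 0" and "E0 *v x + E *v (z - G *v (E0 *v x)) = 0"
        by blast+
      then have E0x: "E0 *v x = E *v (G *v (E0 *v x) - z)"
        by (simp add: matrix_vector_mult_diff_distrib algebra_simps)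
      \<comment> \<open>\<open>E ** G\<close> fixes every vector in the range of \<open>E\<close>,
        and \<open>E0 *v x\<close> is one; hence \<open>E *v z\<close> vanishes.\<close>
      then have "E *v (G *v (E0 *v x)) = E0 *v x"
        by (metis GE)
      with E0x have "E *v z = 0"
        by (simp add: matrix_vector_mult_diff_distrib)
      with Ex E0x show ?thesis
        by (auto simp: vJ)
    qed
    moreover have "?M *v J (x, z) = 0" if "x \<in> ?S" "z \<in> ?N" for x z
      using that GE by (auto simp: M_J matrix_vector_mult_diff_distrib)
    ultimately show ?thesis by auto
  qed
  have subN: "subspace ?N"
    by (auto simp: subspace_def matrix_vector_right_distrib matrix_vector_mult_scaleR)
  have subS: "subspace ?S"
    by (rule subspace_kernel_preimage_range)
  have "dim {v. ?M *v v = 0} = dim (?S \<times> ?N)"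
    unfolding image[symmetric]
    by (rule dim_image_eq[OF linJ]) (use injJ in \<open>auto intro: inj_on_subset\<close>)
  also have "\<dots> = dim ?S + dim ?N"
    by (rule dim_Times[OF subS subN])
  finally show ?thesis
    using rank_plus_nullity[of ?M] rank_plus_nullity[of E] by (simp add: dual_rank_def)
qed

lemma rank_le_dual_rank: "int (rank E) \<le> dual_rank (dual_matrix E E0)"
proof -
  have "dim {x. E *v x = 0 \<and> E0 *v x \<in> range ((*v) E)} \<le> dim {x. E *v x = 0}"
    by (rule dim_subset) auto
  then show ?thesis
    using rank_plus_nullity[of E] by (simp add: dual_rank_eq)
qed

text \<open>Both sides say that \<open>?S\<close> is all of \<open>?N\<close>: as \<open>?S\<close>
  is a subspace of \<open>?N\<close>, comparing dimensions suffices.\<close>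

lemma has_DMPGI_iff_dual_rank_eq:
  "has_DMPGI (dual_matrix E E0) \<longleftrightarrow> dual_rank (dual_matrix E E0) = int (rank E)"
proof -
  let ?N = "{x. E *v x = 0}"
  let ?S = "{x. E *v x = 0 \<and> E0 *v x \<in> range ((*v) E)}"
  have subN: "subspace ?N"
    by (auto simp: subspace_def matrix_vector_right_distrib matrix_vector_mult_scaleR)
  have subS: "subspace ?S"
    by (rule subspace_kernel_preimage_range)
  have "has_DMPGI (dual_matrix E E0) \<longleftrightarrow> ?S = ?N"
    by (auto simp: has_DMPGI_iff)
  also have "\<dots> \<longleftrightarrow> dim ?S = dim ?N"
  proof
    assume "dim ?S = dim ?N"
    then show "?S = ?N"
      by (intro subspace_dim_equal[OF subS subN]) auto
  qed simp
  also have "\<dots> \<longleftrightarrow> dual_rank (dual_matrix E E0) = int (rank E)"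
    using rank_plus_nullity[of E] by (auto simp: dual_rank_eq)
  finally show ?thesis .
qed

theorem theorem3p1:
  fixes E E\<^sub>0 F F\<^sub>0 :: "real^'n^'m"
    and Ehat Fhat :: "dual_num^'n^'m"
  assumes "Ehat = dual_matrix E E\<^sub>0" and "Fhat = dual_matrix F F\<^sub>0"
    and "has_DMPGI Ehat" and "has_DMPGI Fhat"
  shows "dual_minus_le Ehat Fhat \<longleftrightarrow> dual_rank Fhat - dual_rank Ehat = dual_rank (Fhat - Ehat)"
proof -
  have "dual_rank Ehat = int (rank E)" "dual_rank Fhat = int (rank F)"
    using assms has_DMPGI_iff_dual_rank_eq by metis+
  moreover have diff: "Fhat - Ehat = dual_matrix (F - E) (F\<^sub>0 - E\<^sub>0)"
    by (simp add: assms(1,2) dual_matrix_diff)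
  moreover have "int (rank (F - E)) \<le> dual_rank (Fhat - Ehat)"
    unfolding diff by (rule rank_le_dual_rank)
  moreover have "rank F \<le> rank E + rank (F - E)"
    by (rule rank_le_add_rank_diff)
  \<comment> \<open>The two conjuncts are equality in each of the two inequalities above, and
    together these amount to equality in their sum.\<close>
  moreover have "dual_minus_le Ehat Fhat \<longleftrightarrow> int (rank (F - E)) = int (rank F) - int (rank E)
      \<and> dual_rank (Fhat - Ehat) = int (rank (F - E))"
    using assms(3,4)
    by (simp add: dual_minus_le_def minus_le_def diff assms(1,2) has_DMPGI_iff_dual_rank_eq
        dual_matrix_diff)
  ultimately show ?thesis
    by linarith
qed

end
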